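(* Let $m\ge1$ be an integer and let $C=a\,C_a\oplus b\,C_b$ be an $H_{32}$-code of length $n=2m$, with binary component $C_a\subseteq\mathbb{F}_2^{n}$ and ternary component $C_b\subseteq\mathbb{F}_3^{n}$. Then $C$ is a symplectic quasi self-dual (symplectic-QSD) code if and only if $C_a$ is a binary $[n,m]$ code and $C_b$ is a ternary symplectic self-dual code.
   Context: Ring: $H_{32}=\langle a,b\mid 2a=0,\ 3b=0,\ a^2=0,\ b^2=b,\ ab=ba=0\rangle$ is the commutative non-unital ring of order six with elements $0,a,b,a+b,2b,a+2b$. For $\mathbf{x}\in\mathbb{F}_2^n$, $a\mathbf{x}$ is the vector obtained coordinatewise from $a\cdot0=0$, $a\cdot1=a$; for $\mathbf{y}\in\mathbb{F}_3^n$, $b\mathbf{y}$ is obtained coordinatewise from $b\cdot0=0$, $b\cdot1=b$, $b\cdot2=2b$. Every vector of $H_{32}^n$ is uniquely $a\mathbf{x}+b\mathbf{y}$ with $\mathbf{x}\in\mathbb{F}_2^n$, $\mathbf{y}\in\mathbb{F}_3^n$. Codes: an $H_{32}$-code of length $n$ is an $H_{32}$-submodule $C\subseteq H_{32}^n$ (an additive subgroup closed under multiplication by elements of $H_{32}$). It decomposes as $C=aC_a\oplus bC_b=\{a\mathbf{u}+b\mathbf{v}: \mathbf{u}\in C_a,\mathbf{v}\in C_b\}$ with $C_a=\{\mathbf{u}\in\mathbb{F}_2^n: a\mathbf{u}\in C\}$ and $C_b=\{\mathbf{v}\in\mathbb{F}_3^n: b\mathbf{v}\in C\}$, which are linear codes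 over $\mathbb{F}_2$ and $\mathbb{F}_3$ respectively. A linear code of length $n$ and dimension $k$ over $\mathbb{F}_p$ is called an $[n,k]$ code. Symplectic forms: for $\mathbf{x}=(\mathbf{x}_1\mid\mathbf{x}_2),\mathbf{y}=(\mathbf{y}_1\mid\mathbf{y}_2)\in\mathbb{F}_3^{2m}$ with $\mathbf{x}_i,\mathbf{y}_i\in\mathbb{F}_3^m$, set $\langle\mathbf{x},\mathbf{y}\rangle_s^{(\mathbb{F}_3)}=\mathbf{x}_1\cdot\mathbf{y}_2-\mathbf{x}_2\cdot\mathbf{y}_1$, where $\cdot$ is the usual dot product. For $\mathbf{c}=a\mathbf{x}+b\mathbf{y}$, $\mathbf{c}'=a\mathbf{x}'+b\mathbf{y}'$ in $H_{32}^{2m}$ (with $\mathbf{x},\mathbf{x}'\in\mathbb{F}_2^{2m}$, $\mathbf{y},\mathbf{y}'\in\mathbb{F}_3^{2m}$), set $\langle\mathbf{c},\mathbf{c}'\rangle_S=b\langle\mathbf{y},\mathbf{y}'\rangle_s^{(\mathbb{F}_3)}$ (the binary part contributes $0$ because $a^2=0$). The symplectic dual $C^{\perp_S}$ of a code $C$ (over $\mathbb{F}_3$ or $H_{32}$, of length $2m$) is the set of all vectors of the ambient space orthogonal to every element of $C$ under the corresponding symplectic form. $C$ is symplectic self-orthogonal if $C\subseteq C^{\perp_S}$ and symplectic self-dual if $C=C^{\perp_S}$. An $H_{32}$-code of length $2m$ is symplectic quasi self-dual (symplectic-QSD) if it is symplectic self-orthogonal and has exactly $6^m$ elements. *)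

theory Defs
  imports "HOL-Analysis.Analysis" "HOL-Library.Z2"
begin

section \<open>The fields with two and three elements\<close>

text \<open>
  \<^typ>\<open>Enum.finite_3\<close> carries a field instance, with the three constructors in the roles of
  0, 1, 2. The library rewrites 0 and 1 to these constructors; this is switched off so that
  the numerals 0, 1, 2 are the normal forms.
\<close>

type_synonym F2 = bit
type_synonym F3 = Enum.finite_3

declare zero_finite_3_def [simp del] one_finite_3_def [simp del] two_finite_3 [simp del]

lemma F3_cases [case_names 0 1 2, cases type: Enum.finite_3]:
  fixes y :: F3
  obtains "y = 0" | "y = 1" | "y = 2"
  by (cases y rule: finite_3.exhaust)
    (auto simp: zero_finite_3_def one_finite_3_def two_finite_3)

lemma F3_arith [simp]:
  "(1::F3) + 1 = 2" "(1::F3) + 2 = 0" "(2::F3) + 1 = 0" "(2::F3) + 2 = 1" "(2::F3) * 2 = 1" "(3::F3) = 0" "(4::F3) = 1"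
  "- (1::F3) = 2" "- (2::F3) = 1" "(2::F3) \<noteq> 0" "(2::F3) \<noteq> 1" "(0::F3) \<noteq> 2" "(1::F3) \<noteq> 2"
  by (simp_all add: numeral.simps zero_finite_3_def one_finite_3_def two_finite_3
      plus_finite_3_def times_finite_3_def uminus_finite_3_def)

lemma UNIV_F2: "(UNIV :: F2 set) = {0, 1}"
  using bit_not_zero_iff by blast

lemma UNIV_F3: "(UNIV :: F3 set) = {0, 1, 2}"
proof -
  have "y \<in> {0, 1, 2}" for y :: F3
    by (cases y) auto
  then show ?thesis by blast
qed

instance bit :: finite
  by standard (simp add: UNIV_F2)


section \<open>The ring\<close>

text \<open>
  \<open>H32 x y\<close> stands for the element \<open>a x + b y\<close>. The class \<^class>\<open>comm_ring\<close> does not require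
  a unit. The product is forced by \<open>a\<^sup>2 = ab = ba = 0\<close> and \<open>b\<^sup>2 = b\<close>.
\<close>

datatype h32 = H32 (bin: F2) (ter: F3)

instantiation h32 :: comm_ring
begin

definition "0 = H32 0 0"
definition "c + d = H32 (bin c + bin d) (ter c + ter d)"
definition "c - d = H32 (bin c - bin d) (ter c - ter d)"
definition "- c = H32 (- bin c) (- ter c)"
definition "c * d = H32 0 (ter c * ter d)"

instance
  by standard
    (simp_all only: zero_h32_def plus_h32_def minus_h32_def uminus_h32_def times_h32_def
      h32.sel h32.inject h32.collapse ac_simps
      add_0_left right_minus distrib_left diff_conv_add_uminus simp_thms)

end

definition h32_a :: h32 where "h32_a = H32 1 0"
definition h32_b :: h32 where "h32_b = H32 0 1"

lemmas h32_defs = zero_h32_def plus_h32_def minus_h32_def uminus_h32_def times_h32_def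
  h32_a_def h32_b_def

lemma h32_relations:
  "h32_a + h32_a = 0" "h32_b + h32_b + h32_b = 0"
  "h32_a * h32_a = 0" "h32_b * h32_b = h32_b" "h32_a * h32_b = 0" "h32_b * h32_a = 0"
  by (simp_all add: h32_defs)

lemma UNIV_h32:
  "UNIV = {0, h32_a, h32_b, h32_a + h32_b, h32_b + h32_b, h32_a + (h32_b + h32_b)}"
proof -
  have "c \<in> {0, h32_a, h32_b, h32_a + h32_b, h32_b + h32_b, h32_a + (h32_b + h32_b)}" for c
  proof (cases c)
    case (H32 x y)
    then show ?thesis
      by (cases x; cases y) (simp_all add: h32_defs)
  qed
  then show ?thesis by blast
qed

lemma card_h32: "CARD(h32) = 6"
  unfolding UNIV_h32 by (simp add: h32_defs)

instance h32 :: finite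
  by standard (simp add: UNIV_h32)

lemma h32_not_unital: "\<not> (\<exists>e::h32. \<forall>c. e * c = c)"
proof
  assume "\<exists>e::h32. \<forall>c. e * c = c"
  then obtain e :: h32 where "e * h32_a = h32_a" by blast
  then show False by (simp add: h32_defs)
qed


section \<open>Vectors and codes over the ring\<close>

definition a_smul :: "F2 \<Rightarrow> h32" where
  "a_smul x = (if x = 0 then 0 else h32_a)"

definition b_smul :: "F3 \<Rightarrow> h32" where
  "b_smul y = (if y = 0 then 0 else if y = 1 then h32_b else h32_b + h32_b)"

definition a_vec :: "F2 ^ 'n \<Rightarrow> h32 ^ 'n" where
  "a_vec x = (\<chi> i. a_smul (x $ i))"

definition b_vec :: "F3 ^ 'n \<Rightarrow> h32 ^ 'n" where
  "b_vec y = (\<chi> i. b_smul (y $ i))"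

definition ter_vec :: "h32 ^ 'n \<Rightarrow> F3 ^ 'n" where
  "ter_vec c = (\<chi> i. ter (c $ i))"

lemma a_smul_eq: "a_smul x = H32 x 0"
  by (cases x) (simp_all add: a_smul_def h32_defs)

lemma b_smul_eq: "b_smul y = H32 0 y"
  by (cases y) (simp_all add: b_smul_def h32_defs)

lemma h32_vec_decomp: "\<exists>!(x, y). c = a_vec x + b_vec y"
proof (rule ex1I[of _ "(\<chi> i. bin (c $ i), ter_vec c)"])
  show "case (\<chi> i. bin (c $ i), ter_vec c) of (x, y) \<Rightarrow> c = a_vec x + b_vec y"
    by (simp add: vec_eq_iff a_vec_def b_vec_def ter_vec_def a_smul_eq b_smul_eq plus_h32_def
        h32.expand)
next
  fix p assume "case p of (x, y) \<Rightarrow> c = a_vec x + b_vec y"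
  then show "p = (\<chi> i. bin (c $ i), ter_vec c)"
    by (cases p)
      (simp add: vec_eq_iff a_vec_def b_vec_def ter_vec_def a_smul_eq b_smul_eq plus_h32_def)
qed

lemma ter_vec_decomp [simp]: "ter_vec (a_vec x + b_vec y) = y"
  by (simp add: vec_eq_iff a_vec_def b_vec_def ter_vec_def a_smul_eq b_smul_eq plus_h32_def)

text \<open>\<open>r *s c\<close> multiplies coordinatewise; it needs no unit in the ring.\<close>

definition h32_code :: "(h32 ^ 'n) set \<Rightarrow> bool" where
  "h32_code C \<longleftrightarrow>
     0 \<in> C \<and> (\<forall>c\<in>C. \<forall>d\<in>C. c + d \<in> C) \<and> (\<forall>c\<in>C. - c \<in> C) \<and> (\<forall>r. \<forall>c\<in>C. r *s c \<in> C)"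

definition bin_component :: "(h32 ^ 'n) set \<Rightarrow> (F2 ^ 'n) set" where
  "bin_component C = {u. a_vec u \<in> C}"

definition ter_component :: "(h32 ^ 'n) set \<Rightarrow> (F3 ^ 'n) set" where
  "ter_component C = {v. b_vec v \<in> C}"

lemma h32_code_decomp:
  assumes "h32_code C"
  shows "C = {a_vec u + b_vec v | u v. u \<in> bin_component C \<and> v \<in> ter_component C}"
proof (intro equalityI subsetI)
  fix c assume c: "c \<in> C"
  obtain u v where uv: "c = a_vec u + b_vec v"
    using h32_vec_decomp[of c] by auto
  have bv: "h32_b *s c = b_vec v"
    by (simp add: uv vec_eq_iff a_vec_def b_vec_def a_smul_eq b_smul_eq h32_defs)
  then have v: "b_vec v \<in> C"
    using assms c by (metis h32_code_def)
  have "a_vec u = c + - b_vec v"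
    by (simp add: uv)
  then have "a_vec u \<in> C"
    using assms c v unfolding h32_code_def by metis
  with v uv show "c \<in> {a_vec u + b_vec v | u v. u \<in> bin_component C \<and> v \<in> ter_component C}"
    by (auto simp: bin_component_def ter_component_def)
next
  fix c assume "c \<in> {a_vec u + b_vec v | u v. u \<in> bin_component C \<and> v \<in> ter_component C}"
  then show "c \<in> C"
    using assms by (auto simp: bin_component_def ter_component_def h32_code_def)
qed

definition nk_code :: "nat \<Rightarrow> nat \<Rightarrow> ('a::field ^ 'n) set \<Rightarrow> bool" where
  "nk_code n k D \<longleftrightarrow> CARD('n) = n \<and> vec.subspace D \<and> vec.dim D = k"


section \<open>Symplectic forms and duality\<close>

text \<open>
  Vectors of length \<open>2m\<close> are indexed by the sum type \<open>'m + 'm\<close> with \<open>m = CARD('m)\<close>, so that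
  \<open>x = (x\<^sub>1 | x\<^sub>2)\<close> has its first half at the indices \<open>Inl i\<close> and its second half at \<open>Inr i\<close>.
\<close>

definition left_half :: "'a ^ ('m::finite + 'm) \<Rightarrow> 'a ^ 'm" where
  "left_half x = (\<chi> i. x $ Inl i)"

definition right_half :: "'a ^ ('m::finite + 'm) \<Rightarrow> 'a ^ 'm" where
  "right_half x = (\<chi> i. x $ Inr i)"

definition dot :: "'a::comm_ring ^ 'm \<Rightarrow> 'a ^ 'm \<Rightarrow> 'a" where
  "dot u v = (\<Sum>i\<in>UNIV. u $ i * v $ i)"

definition symp_F3 :: "F3 ^ ('m::finite + 'm) \<Rightarrow> F3 ^ ('m + 'm) \<Rightarrow> F3" where
  "symp_F3 x y = dot (left_half x) (right_half y) - dot (right_half x) (left_half y)"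

definition symp_h32 :: "h32 ^ ('m::finite + 'm) \<Rightarrow> h32 ^ ('m + 'm) \<Rightarrow> h32" where
  "symp_h32 c d = b_smul (symp_F3 (ter_vec c) (ter_vec d))"

definition dual_code :: "('v \<Rightarrow> 'v \<Rightarrow> 'r::zero) \<Rightarrow> 'v set \<Rightarrow> 'v set" where
  "dual_code B C = {x. \<forall>c\<in>C. B x c = 0}"

definition ternary_symplectic_self_dual :: "(F3 ^ ('m::finite + 'm)) set \<Rightarrow> bool" where
  "ternary_symplectic_self_dual D \<longleftrightarrow> vec.subspace D \<and> D = dual_code symp_F3 D"

definition symplectic_QSD :: "(h32 ^ ('m::finite + 'm)) set \<Rightarrow> bool" where
  "symplectic_QSD C \<longleftrightarrow>
     h32_code C \<and> C \<subseteq> dual_code symp_h32 C \<and> card C = 6 ^ CARD('m)"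

end

theory Submission
  imports Defs
begin

text \<open>
  Since \<open>|C| = |C\<^sub>a| |C\<^sub>b| = 2\<^sup>k 3\<^sup>l\<close>, the size condition \<open>|C| = 6\<^sup>m\<close> says \<open>k = l = m\<close>, and \<open>C\<close> is
  self-orthogonal iff \<open>C\<^sub>b\<close> is. The symplectic form is nondegenerate, so \<open>|D| |D\<^sup>\<bottom>| = 3\<^sup>2\<^sup>m\<close> for
  every ternary code \<open>D\<close>; hence a self-orthogonal \<open>D\<close> is self-dual iff it has dimension \<open>m\<close>.
\<close>

section \<open>Counting in vector spaces over a finite field\<close>

text \<open>The representation \<open>k *s b + y\<close> is unique: two different scalars would let
  one solve for \<open>b\<close> inside \<open>S\<close>. This one count serves both adjoining a
  basis vector to a span and splitting a space along the kernel of a functional.\<close>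

lemma card_subspace_sum_line:
  fixes S :: "('a::{field,finite} ^ 'n) set"
  assumes S: "vec.subspace S" and b: "b \<notin> S"
  shows "card ((\<lambda>(k, y). k *s b + y) ` (UNIV \<times> S)) = CARD('a) * card S"
proof -
  have "inj_on (\<lambda>(k, y). k *s b + y) (UNIV \<times> S)"
  proof (rule inj_onI, clarify)
    fix k y l z
    assume y: "y \<in> S" and z: "z \<in> S" and eq: "k *s b + y = l *s b + z"
    have d: "(k - l) *s b = z - y"
      using eq by (simp add: vec.scale_left_diff_distrib algebra_simps)
    have "k = l"
    proof (rule ccontr)
      assume "k \<noteq> l"
      have "inverse (k - l) *s (z - y) = (inverse (k - l) * (k - l)) *s b"
        by (simp only: d [symmetric] vec.scale_scale)
      with \<open>k \<noteq> l\<close> have "b = inverse (k - l) *s (z - y)" by simp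
      with b S y z show False
        by (metis vec.subspace_diff vec.subspace_scale)
    qed
    with eq show "k = l \<and> y = z" by simp
  qed
  then show ?thesis
    by (simp add: card_image card_cartesian_product)
qed

lemma card_span_independent:
  fixes B :: "('a::{field,finite} ^ 'n) set"
  assumes "vec.independent B"
  shows "card (vec.span B) = CARD('a) ^ card B"
proof -
  have "finite B" by simp
  then show ?thesis using assms
  proof (induction B)
    case empty
    then show ?case by simp
  next
    case (insert b B)
    have ind: "vec.independent B" and b: "b \<notin> vec.span B"
      using insert.prems insert.hyps by (auto simp: vec.independent_insert)
    have "vec.span (insert b B) = (\<lambda>(k, y). k *s b + y) ` (UNIV \<times> vec.span B)"
    proof (intro equalityI subsetI)
      fix x assume "x \<in> vec.span (insert b B)"
      then obtain k where "x - k *s b \<in> vec.span B"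
        by (auto simp: vec.span_insert)
      then have "(k, x - k *s b) \<in> UNIV \<times> vec.span B" by simp
      then show "x \<in> (\<lambda>(k, y). k *s b + y) ` (UNIV \<times> vec.span B)"
        by (rule rev_image_eqI) simp
    next
      fix x assume "x \<in> (\<lambda>(k, y). k *s b + y) ` (UNIV \<times> vec.span B)"
      then obtain k y where "x = k *s b + y" "y \<in> vec.span B" by auto
      then have "x - k *s b \<in> vec.span B" by simp
      then show "x \<in> vec.span (insert b B)" by (auto simp: vec.span_insert)
    qed
    then show ?case
      using card_subspace_sum_line[OF vec.subspace_span b] insert ind by simp
  qed
qed

lemma card_subspace:
  fixes D :: "('a::{field,finite} ^ 'n) set"
  assumes "vec.subspace D"
  shows "card D = CARD('a) ^ vec.dim D"
proof -
  obtain B where B: "B \<subseteq> D" "vec.independent B" "D \<subseteq> vec.span B" "card B = vec.dim D"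
    using vec.basis_exists[of D] by metis
  then have "vec.span B = D"
    using assms by (simp add: subset_antisym vec.span_minimal)
  with card_span_independent[OF B(2)] B(4) show ?thesis by simp
qed

text \<open>A functional that does not vanish at \<open>w\<close> splits \<open>W\<close> as the
  line through \<open>w\<close> plus the kernel, so the kernel has index \<open>CARD('a)\<close> in
  \<open>W\<close>.\<close>

lemma card_kernel_functional:
  fixes f :: "'a::{field,finite} ^ 'n \<Rightarrow> 'a"
  assumes f: "Vector_Spaces.linear (*s) (*) f" and W: "vec.subspace W"
    and w: "w \<in> W" "f w \<noteq> 0"
  shows "CARD('a) * card {x \<in> W. f x = 0} = card W"
proof -
  interpret f: Vector_Spaces.linear "(*s)" "(*)" f by (fact f)
  let ?K = "{x \<in> W. f x = 0}"
  have K: "vec.subspace ?K"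
    using W by (auto simp: vec.subspace_def f.add f.scale f.zero)
  have "W = (\<lambda>(k, y). k *s w + y) ` (UNIV \<times> ?K)"
  proof (intro equalityI subsetI)
    fix x assume x: "x \<in> W"
    \<comment> \<open>This is the scalar for which \<open>f (x - ?k *s w) = 0\<close>.\<close>
    let ?k = "f x / f w"
    have "x - ?k *s w \<in> ?K"
      using x w W by (simp add: vec.subspace_diff vec.subspace_scale f.diff f.scale)
    then have "(?k, x - ?k *s w) \<in> UNIV \<times> ?K" by simp
    then show "x \<in> (\<lambda>(k, y). k *s w + y) ` (UNIV \<times> ?K)"
      by (rule rev_image_eqI) simp
  qed (use w W in \<open>auto simp: vec.subspace_add vec.subspace_scale\<close>)
  then show ?thesis
    using card_subspace_sum_line[OF K, of w] w by simp
qed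

text \<open>Double counting of the pairs \<open>(x, c)\<close> with \<open>c \<in> D\<close> and \<open>B x c = 0\<close>.\<close>

lemma card_mult_card_dual_code:
  fixes B :: "'a::{field,finite} ^ 'n \<Rightarrow> 'a ^ 'n \<Rightarrow> 'a"
  assumes linl: "\<And>c. Vector_Spaces.linear (*s) (*) (\<lambda>x. B x c)"
    and linr: "\<And>x. Vector_Spaces.linear (*s) (*) (B x)"
    and nondeg: "\<And>c. c \<noteq> 0 \<Longrightarrow> \<exists>x. B x c \<noteq> 0"
    and D: "vec.subspace D"
  shows "card D * card (dual_code B D) = CARD('a) ^ CARD('n)"
proof -
  let ?q = "CARD('a)" and ?V = "UNIV :: ('a ^ 'n) set" and ?P = "dual_code B D"
  have "(\<Sum>x\<in>?V. card {c\<in>D. B x c = 0}) = (\<Sum>c\<in>D. card {x\<in>?V. B x c = 0})"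
    by (rule sum_multicount_gen) auto
  \<comment> \<open>The factor \<open>?q\<close> lets the kernel sizes be replaced below without
    dividing.\<close>
  then have eq: "(\<Sum>x\<in>?V. ?q * card {c\<in>D. B x c = 0}) = (\<Sum>c\<in>D. ?q * card {x\<in>?V. B x c = 0})"
    by (simp flip: sum_distrib_left)
  \<comment> \<open>Outside the dual, \<open>B x\<close> is a nonzero functional on
    \<open>D\<close>. The columns are treated alike, with nondegeneracy supplying a nonzero value
    when \<open>c\<close> is nonzero.\<close>
  have row: "?q * card {c\<in>D. B x c = 0} = (if x \<in> ?P then ?q * card D else card D)" for x
  proof (cases "x \<in> ?P")
    case True
    then have "{c\<in>D. B x c = 0} = D" by (auto simp: dual_code_def)
    with True show ?thesis by simp
  next
    case False
    then obtain c where "c \<in> D" "B x c \<noteq> 0" by (auto simp: dual_code_def)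
    with False card_kernel_functional[OF linr D] show ?thesis by simp
  qed
  have col: "?q * card {x\<in>?V. B x c = 0} = (if c = 0 then ?q * card ?V else card ?V)" for c
  proof (cases "c = 0")
    case True
    interpret B: Vector_Spaces.linear "(*s)" "(*)" "B x" for x by (fact linr)
    from True B.zero show ?thesis by simp
  next
    case False
    then obtain x where "B x c \<noteq> 0" using nondeg by blast
    with False card_kernel_functional[OF linl vec.subspace_UNIV, of x c] show ?thesis by simp
  qed
  have "0 \<in> D" using D by (rule vec.subspace_0)
  then have "D \<inter> {c. c = 0} = {0}" "D \<inter> - {c. c = 0} = D - {0}" by auto
  then have "card ?P * (?q * card D) + card (- ?P) * card D
      = ?q * card ?V + card (D - {0}) * card ?V"
    using eq unfolding row col by (simp add: sum.If_cases)
  \<comment> \<open>Over the integers the complements become differences, and the identity factors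
    with the nonzero factor \<open>int ?q - 1\<close>.\<close>
  then have "int (card ?P) * (int ?q * int (card D)) + int (card (- ?P)) * int (card D)
      = int ?q * int (card ?V) + int (card (D - {0})) * int (card ?V)"
    by (simp only: of_nat_eq_iff flip: of_nat_mult of_nat_add)
  moreover have "int (card (- ?P)) = int (card ?V) - int (card ?P)"
    by (simp only: Compl_eq_Diff_UNIV card_Diff_subset finite subset_UNIV of_nat_diff card_mono)
  moreover have "int (card (D - {0})) = int (card D) - 1"
    using \<open>0 \<in> D\<close> card_Suc_Diff1[of D 0] by simp
  ultimately have "(int ?q - 1) * (int (card D) * int (card ?P) - int (card ?V)) = 0"
    by algebra
  moreover have "?q > 1"
    using card_mono[of UNIV "{0, 1 :: 'a}"] by simp
  ultimately have "int (card D) * int (card ?P) = int (card ?V)" by simp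
  then have "card D * card ?P = card ?V" by (simp only: of_nat_eq_iff flip: of_nat_mult)
  then show ?thesis by simp
qed


section \<open>The ternary symplectic form\<close>

lemma card_F3: "CARD(F3) = 3"
  by (simp add: UNIV_F3)

lemma card_F2: "CARD(F2) = 2"
  by (simp add: UNIV_F2)

lemma symp_F3_sum:
  "symp_F3 x y = (\<Sum>i\<in>UNIV. x $ Inl i * y $ Inr i - x $ Inr i * y $ Inl i)"
  by (simp add: symp_F3_def dot_def left_half_def right_half_def sum_subtractf)

lemma linear_symp_F3_left: "Vector_Spaces.linear (*s) (*) (\<lambda>x. symp_F3 x y)"
  by unfold_locales
    (simp_all add: symp_F3_sum sum_distrib_left flip: sum.distrib, simp_all add: algebra_simps)

lemma linear_symp_F3_right: "Vector_Spaces.linear (*s) (*) (symp_F3 x)"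
  by unfold_locales
    (simp_all add: symp_F3_sum sum_distrib_left flip: sum.distrib, simp_all add: algebra_simps)

lemma symp_F3_nondegenerate:
  assumes "c \<noteq> 0"
  shows "\<exists>x. symp_F3 x c \<noteq> 0"
proof -
  obtain j where j: "c $ j \<noteq> 0"
    using assms by (auto simp: vec_eq_iff)
  show ?thesis
  proof (cases j)
    case (Inl i)
    \<comment> \<open>The form pairs coordinate \<open>Inl i\<close> with \<open>Inr i\<close>, so
      the unit vector at the partner of \<open>j\<close> isolates \<open>c $ j\<close> up to
      sign.\<close>
    have "symp_F3 (axis (Inr i) 1) c = - (c $ j)"
      by (simp add: symp_F3_sum axis_def Inl if_distrib[of "\<lambda>u. u * _"] sum_negf cong: if_cong)
    with j show ?thesis by (metis neg_equal_0_iff_equal)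
  next
    case (Inr i)
    have "symp_F3 (axis (Inl i) 1) c = c $ j"
      by (simp add: symp_F3_sum axis_def Inr if_distrib[of "\<lambda>u. u * _"] cong: if_cong)
    with j show ?thesis by metis
  qed
qed

lemma card_dual_code_symp_F3:
  fixes D :: "(F3 ^ ('m::finite + 'm)) set"
  assumes "vec.subspace D"
  shows "card D * card (dual_code symp_F3 D) = (3 ^ CARD('m))\<^sup>2"
  using card_mult_card_dual_code[OF linear_symp_F3_left linear_symp_F3_right
      symp_F3_nondegenerate assms]
  by (simp add: card_F3 card_UNIV_sum power_add power2_eq_square)

lemma ternary_self_dual_iff:
  fixes D :: "(F3 ^ ('m::finite + 'm)) set"
  assumes D: "vec.subspace D"
  shows "ternary_symplectic_self_dual D \<longleftrightarrow>
    D \<subseteq> dual_code symp_F3 D \<and> card D = 3 ^ CARD('m)"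
proof
  assume "ternary_symplectic_self_dual D"
  then have eq: "dual_code symp_F3 D = D" by (simp add: ternary_symplectic_self_dual_def)
  then have "(card D)\<^sup>2 = (3 ^ CARD('m))\<^sup>2"
    using card_dual_code_symp_F3[OF D] by (simp add: power2_eq_square)
  with eq show "D \<subseteq> dual_code symp_F3 D \<and> card D = 3 ^ CARD('m)"
    by (simp add: power2_eq_iff_nonneg)
next
  assume *: "D \<subseteq> dual_code symp_F3 D \<and> card D = 3 ^ CARD('m)"
  \<comment> \<open>Cancelling one factor \<open>3 ^ CARD('m)\<close> gives equal sizes, so the
    inclusion of finite sets is an equality.\<close>
  then have "card (dual_code symp_F3 D) = card D"
    using card_dual_code_symp_F3[OF D] by (simp add: power2_eq_square)
  with * D show "ternary_symplectic_self_dual D"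
    by (simp add: ternary_symplectic_self_dual_def card_subset_eq)
qed


section \<open>Components of an \<open>H\<^sub>3\<^sub>2\<close>-code\<close>

lemma subspace_bin_component:
  fixes C :: "(h32 ^ 'n) set"
  assumes "h32_code C"
  shows "vec.subspace (bin_component C)"
proof -
  have "a_vec (0 :: F2 ^ 'n) = 0" "\<And>u v :: F2 ^ 'n. a_vec (u + v) = a_vec u + a_vec v"
    by (simp_all add: vec_eq_iff a_vec_def a_smul_eq h32_defs)
  \<comment> \<open>Closure under ring multiplication is no help here, since every ring element
    annihilates \<open>a_vec u\<close>; but the only scalars are 0 and 1.\<close>
  moreover have "k *s u \<in> bin_component C" if "u \<in> bin_component C" for k u
    using that assms \<open>a_vec 0 = 0\<close> by (cases k) (auto simp: bin_component_def h32_code_def)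
  ultimately show ?thesis
    using assms by (auto simp: vec.subspace_def bin_component_def h32_code_def)
qed

lemma subspace_ter_component:
  fixes C :: "(h32 ^ 'n) set"
  assumes "h32_code C"
  shows "vec.subspace (ter_component C)"
proof -
  have "b_vec (0 :: F3 ^ 'n) = 0" "\<And>u v :: F3 ^ 'n. b_vec (u + v) = b_vec u + b_vec v"
    \<comment> \<open>As \<open>b\<close> is idempotent, the ring element \<open>k b\<close> acts on
      \<open>b_vec u\<close> as the ternary scalar \<open>k\<close>.\<close>
    "\<And>k (u :: F3 ^ 'n). b_vec (k *s u) = H32 0 k *s b_vec u"
    by (simp_all add: vec_eq_iff b_vec_def b_smul_eq h32_defs)
  then show ?thesis
    using assms by (auto simp: vec.subspace_def ter_component_def h32_code_def)
qed

lemma card_h32_code: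
  assumes "h32_code C"
  shows "card C = card (bin_component C) * card (ter_component C)"
proof -
  let ?f = "\<lambda>(u, v). a_vec u + b_vec v"
  have "C = ?f ` (bin_component C \<times> ter_component C)"
    by (subst h32_code_decomp[OF assms]) auto
  moreover have "inj_on ?f (bin_component C \<times> ter_component C)"
  proof (rule inj_onI)
    fix p q assume "?f p = ?f q"
    moreover have "\<exists>!r. ?f p = ?f r"
      using h32_vec_decomp[of "?f p"] by (simp add: case_prod_unfold)
    ultimately show "p = q" by metis
  qed
  ultimately show ?thesis
    by (metis card_image card_cartesian_product)
qed

lemma ter_vec_image:
  assumes "h32_code C"
  shows "ter_vec ` C = ter_component C"
proof -
  \<comment> \<open>Hence each \<open>v\<close> in \<open>ter_component C\<close> is attained, as
    the ternary part of the codeword \<open>a_vec 0 + b_vec v\<close>.\<close>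
  have "0 \<in> bin_component C"
    using subspace_bin_component[OF assms] by (rule vec.subspace_0)
  then show ?thesis
    by (subst h32_code_decomp[OF assms]) force
qed

text \<open>The form on the ring sees codewords only through \<open>ter_vec\<close>, whose image of
  \<open>C\<close> is the ternary component, and \<open>b_smul\<close> vanishes only at 0.\<close>

lemma self_orthogonal_iff_ter_component:
  assumes "h32_code C"
  shows "C \<subseteq> dual_code symp_h32 C \<longleftrightarrow>
    ter_component C \<subseteq> dual_code symp_F3 (ter_component C)"
proof -
  have "b_smul y = 0 \<longleftrightarrow> y = 0" for y
    by (simp add: b_smul_eq zero_h32_def)
  then show ?thesis
    by (auto simp: dual_code_def symp_h32_def subset_iff simp flip: ter_vec_image[OF assms])
qed

theorem lemma4p9:
  fixes C :: "(h32 ^ ('m::finite + 'm)) set"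
  assumes "h32_code C"
  shows "symplectic_QSD C \<longleftrightarrow>
    nk_code (2 * CARD('m)) CARD('m) (bin_component C) \<and>
    ternary_symplectic_self_dual (ter_component C)"
proof -
  let ?m = "CARD('m)" and ?Ca = "bin_component C" and ?Cb = "ter_component C"
  have Ca: "vec.subspace ?Ca" and Cb: "vec.subspace ?Cb"
    using assms by (rule subspace_bin_component, rule subspace_ter_component)
  have cardCa: "card ?Ca = 2 ^ vec.dim ?Ca" and cardCb: "card ?Cb = 3 ^ vec.dim ?Cb"
    using card_subspace[OF Ca] card_subspace[OF Cb] by (simp_all add: card_F2 card_F3)
  have "(6::nat) ^ ?m = 2 ^ ?m * 3 ^ ?m"
    by (simp flip: power_mult_distrib)
  \<comment> \<open>The component sizes are powers of 2 and of 3, so their product equals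
    \<open>2 ^ ?m * 3 ^ ?m\<close> only if the factors agree one by one.\<close>
  moreover have "coprime (2::nat) 3"
    by (simp add: coprime_iff_gcd_eq_1 gcd_non_0_nat)
  ultimately have "card C = 6 ^ ?m \<longleftrightarrow> card ?Ca = 2 ^ ?m \<and> card ?Cb = 3 ^ ?m"
    using card_h32_code[OF assms] cardCa cardCb
      coprime_crossproduct_nat[of "card ?Ca" "3 ^ ?m" "2 ^ ?m" "card ?Cb"]
    by simp
  moreover have "nk_code (2 * ?m) ?m ?Ca \<longleftrightarrow> card ?Ca = 2 ^ ?m"
    using Ca cardCa by (simp add: nk_code_def card_UNIV_sum)
  ultimately show ?thesis
    using assms by (auto simp: symplectic_QSD_def self_orthogonal_iff_ter_component
        ternary_self_dual_iff[OF Cb])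
qed

end
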